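(* Let $d\ge 2$ and $r\ge 3$ be integers and let $G=([d],E)$ be any connected directed graph with all self-loops present. Then there exists a proper algebraic subset $\mathcal{N}_G\subset\Theta_G$ such that for all $\theta\in\Theta_G\setminus\mathcal{N}_G$, $$\varphi_{G,r}^{-1}(\varphi_{G,r}(\theta)) = \{c\,\theta \mid c>0\}.$$
   Context: $[d]=\{1,\dots,d\}$. $G=([d],E)$ is a directed graph with edge set $E$ (self-loops $i\to i$ and two-cycles allowed); connected means that the underlying undirected graph is connected. $\mathbb{R}^E=\{M\in\mathbb{R}^{d\times d} \mid M_{ij}=0 \text{ if } j\to i\notin E\}$, and $\mathbb{R}^E_{\mathrm{stab}}$ is the subset of matrices in $\mathbb{R}^E$ that are stable, i.e. all eigenvalues have negative real part. The parameter set is $\Theta_G=\mathbb{R}^E_{\mathrm{stab}}\times\mathbb{R}_+^d\times(\mathbb{R}\setminus\{0\})^d$, where $\mathbb{R}_+=(0,\infty)$. Its elements are written $\theta=(M,\mathcal{C}_2,\mathcal{C}_r)$, where $\mathcal{C}_2\in\mathbb{R}^d_+$ is identified with the diagonal $d\times d$ matrix with this diagonal, and $\mathcal{C}_r\in(\mathbb{R}\setminus\{0\})^d$ with the diagonal $r$-th-order $d\times\cdots\times d$ tensor (all entries zero except the $(i,\dots,i)$ entries) with this diagonal; $c\theta=(cM,c\,\mathcal{C}_2,c\,\mathcal{C}_r)$. For a tensor $T$ with $d\times\cdots\times d$ entries and a $d\times d$ matrix $M$, $(T\times_n M)_{i_1\cdots i_{n-1}\,j\,i_{n+1}\cdots i_N}=\sum_{i_n}T_{i_1\cdots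 i_N}M_{j i_n}$. The map $\varphi_{G,r}$ sends $\theta=(M,\mathcal{C}_2,\mathcal{C}_r)\in\Theta_G$ to the pair $(\Sigma,\mathcal{K})$, where $\Sigma$ is the unique $d\times d$ matrix with $M\Sigma+\Sigma M^T+\mathcal{C}_2=0$ and $\mathcal{K}$ is the unique $r$-th-order $d\times\cdots\times d$ tensor with $\mathcal{K}\times_1M+\cdots+\mathcal{K}\times_rM+\mathcal{C}_r=0$ (these exist and are unique since $M$ is stable; $\Sigma$ is symmetric positive definite and $\mathcal{K}$ is symmetric). A proper algebraic subset of $\Theta_G$ is a proper subset of $\Theta_G$ that is the set of points of $\Theta_G$ where a collection of polynomials (in the free entries of $M$ and the diagonals of $\mathcal{C}_2,\mathcal{C}_r$) all vanish. *)

theory Defs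
  imports "Graph_Theory.Digraph_Component" "HOL-Analysis.Analysis"
begin

text \<open>
  The node set \<open>[d]\<close> is a finite type \<open>'d\<close> with \<open>CARD('d) = d\<close>, and the modes of a tensor of
  order \<open>r\<close> are indexed by a finite type \<open>'r\<close> with \<open>CARD('r) = r\<close>. A multi-index is a function
  \<open>'r \<Rightarrow> 'd\<close>, so the \<open>r\<close>-th-order \<open>d \<times> \<dots> \<times> d\<close> tensors form the space \<open>real^('r \<Rightarrow> 'd)\<close>.
  A graph \<open>G\<close> on \<open>[d]\<close> is a \<open>pair_pre_digraph\<close> with \<open>pverts G = UNIV\<close>; its edge \<open>j \<rightarrow> i\<close> is the
  pair \<open>(j, i)\<close>.
\<close>

type_synonym ('d, 'r) tensor = "real ^ ('r \<Rightarrow> 'd)"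

text \<open>A parameter is a triple of \<open>M\<close> and the two diagonals \<open>C\<^sub>2\<close> and \<open>C\<^sub>r\<close>.\<close>

type_synonym 'd param = "(real ^ 'd ^ 'd) \<times> (real ^ 'd) \<times> (real ^ 'd)"

definition complex_eigenvalue :: "real ^ 'd ^ 'd \<Rightarrow> complex \<Rightarrow> bool" where
  "complex_eigenvalue M l \<longleftrightarrow> (\<exists>v. v \<noteq> 0 \<and> map_matrix complex_of_real M *v v = l *s v)"

definition stable :: "real ^ 'd ^ 'd \<Rightarrow> bool" where
  "stable M \<longleftrightarrow> (\<forall>l. complex_eigenvalue M l \<longrightarrow> Re l < 0)"

definition graph_matrices :: "('d::finite) pair_pre_digraph \<Rightarrow> (real ^ 'd ^ 'd) set" where
  "graph_matrices G = {M. \<forall>i j. (j, i) \<notin> parcs G \<longrightarrow> M $ i $ j = 0}"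

definition Theta :: "('d::finite) pair_pre_digraph \<Rightarrow> 'd param set" where
  "Theta G = {M \<in> graph_matrices G. stable M} \<times> {c. \<forall>i. c $ i > 0} \<times> {c. \<forall>i. c $ i \<noteq> 0}"

definition diag_matrix :: "real ^ 'd \<Rightarrow> real ^ 'd ^ 'd" where
  "diag_matrix c = (\<chi> i j. if i = j then c $ i else 0)"

text \<open>The sum below has at most one nonzero term: the entry at \<open>(k, \<dots>, k)\<close> is \<open>c $ k\<close>, all
  other entries are zero.\<close>

definition diag_tensor :: "real ^ 'd \<Rightarrow> ('d::finite, 'r::finite) tensor" where
  "diag_tensor c = (\<chi> i. \<Sum>k\<in>UNIV. if i = (\<lambda>_. k) then c $ k else 0)"

definition mode_product :: "('d::finite, 'r::finite) tensor \<Rightarrow> 'r \<Rightarrow> real ^ 'd ^ 'd \<Rightarrow> ('d, 'r) tensor" where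
  "mode_product T n M = (\<chi> i. \<Sum>k\<in>UNIV. T $ (i(n := k)) * M $ i n $ k)"

text \<open>The first argument of \<open>phi\<close> only fixes the order \<open>r = CARD('r)\<close>. The map of interest is the
  restriction of \<open>phi TYPE('r)\<close> to \<open>Theta G\<close>, where both descriptions are well defined because
  \<open>M\<close> is stable.\<close>

definition phi :: "('r::finite) itself \<Rightarrow> ('d::finite) param \<Rightarrow> (real ^ 'd ^ 'd) \<times> ('d::finite, 'r::finite) tensor" where
  "phi _ = (\<lambda>(M, c2, cr).
     (THE S. M ** S + S ** transpose M + diag_matrix c2 = 0,
      THE K. (\<Sum>n\<in>UNIV. mode_product K n M) + diag_tensor cr = 0))"

text \<open>Every polynomial in the free entries of \<open>M\<close> and the two diagonals is the restriction to
  \<open>Theta G\<close> of a polynomial function on the whole parameter space, and conversely: the remaining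
  entries of \<open>M\<close> vanish on \<open>Theta G\<close>.\<close>

definition proper_algebraic_subset :: "('d::finite) pair_pre_digraph \<Rightarrow> 'd param set \<Rightarrow> bool" where
  "proper_algebraic_subset G N \<longleftrightarrow>
     N \<subset> Theta G \<and>
     (\<exists>P. (\<forall>p\<in>P. real_polynomial_function p) \<and> N = {\<theta> \<in> Theta G. \<forall>p\<in>P. p \<theta> = 0})"

end

theory Submission
  imports Defs "HOL-Computational_Algebra.Fundamental_Theorem_Algebra" "HOL-Real_Asymp.Real_Asymp"
begin

text \<open>
  For given \<open>(\<Sigma>, \<K>)\<close> the two Lyapunov equations are linear in \<open>(M, C\<^sub>2, C\<^sub>r)\<close>. If \<open>\<theta> = (M, C\<^sub>2, C\<^sub>r)\<close> and
  \<open>(M', C\<^sub>2', C\<^sub>r')\<close> lie in one fibre, choose \<open>c > 0\<close> such that the first noise diagonals of \<open>c \<theta>\<close> and of the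
  second point agree at one fixed node. The difference \<open>P = M' - c M\<close> then satisfies a homogeneous
  linear system whose coefficients are entries of \<open>\<Sigma>\<close> and \<open>\<K>\<close>: the off-diagonal entries of both
  equations, the entry of the first one at the chosen node, and the support condition. If this system
  has only the solution \<open>0\<close>, the fibre is the ray through \<open>\<theta>\<close> (\<open>fibre_eq_ray\<close>).

  Solutions of the Lyapunov equations exist uniquely, because the Lyapunov operator of a stable
  matrix is injective: a kernel element would give a common eigenvector of the commuting mode
  products, and eigenvalues of \<open>M\<close> that sum to \<open>0\<close> (\<open>tensor_lyapunov_eq_0_imp\<close>). By Cramer's rule \<open>\<Sigma>\<close>
  and \<open>\<K>\<close> are rational in \<open>\<theta>\<close>, so after clearing denominators injectivity of the system for \<open>P\<close> is
  certified by the nonvanishing of a determinant that is polynomial in \<open>\<theta>\<close>, and it suffices to find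
  a single parameter where the system is injective (\<open>trivial_compatible_directions_polynomial\<close>).

  Such a parameter is found by perturbing the diagonal model \<open>M = -1\<close>. There \<open>\<K>\<close> is diagonal, and since
  \<open>r \<ge> 3\<close> the equations for \<open>\<K>\<close> force \<open>P\<close> to be diagonal. For \<open>M = -1 + e N\<close>, with \<open>N\<close> the adjacency
  matrix of the graph without loops, the terms of order \<open>e\<close> couple the two orders and force the
  diagonal entries of \<open>P\<close> to agree along every edge. By connectedness they are all equal, and the
  normalization at the chosen node makes them vanish (\<open>limit_direction_eq_0\<close>).
\<close>

section \<open>Eigenvectors in invariant subspaces\<close>

text \<open>A complex-linear operator on \<open>\<complex>\<^sup>n\<close>. Only the two linearity laws are recorded.\<close>

locale complex_operator =
  fixes T :: "complex ^ 'n \<Rightarrow> complex ^ 'n"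
  assumes T_add: "T (x + y) = T x + T y"
    and T_scale: "T (c *s x) = c *s T x"
begin

lemma T_0: "T 0 = 0"
  using T_scale[of 0 0] by simp

text \<open>\<open>act p x\<close> is \<open>p(T) x\<close>, evaluated by the Horner scheme.\<close>

definition act :: "complex poly \<Rightarrow> complex ^ 'n \<Rightarrow> complex ^ 'n" where
  "act p x = fold_coeffs (\<lambda>a v. a *s x + T v) p 0"

lemma act_0 [simp]: "act 0 x = 0"
  by (simp add: act_def)

lemma act_pCons [simp]: "act (pCons a p) x = a *s x + T (act p x)"
  by (cases "a = 0"; cases "p = 0") (auto simp: act_def T_0)

lemma act_add: "act (p + q) x = act p x + act q x"
  by (induction p q rule: poly_induct2) (auto simp: T_add vector_sadd_rdistrib algebra_simps)

lemma act_smult: "act (smult c p) x = c *s act p x"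
  by (induction p) (auto simp: T_scale vector_add_ldistrib)

lemma act_monom: "act (monom c i) x = c *s (T ^^ i) x"
  by (induction i) (auto simp: monom_0 monom_Suc T_scale T_0)

lemma act_sum: "act (\<Sum>i\<in>I. p i) x = (\<Sum>i\<in>I. act (p i) x)"
  by (induction I rule: infinite_finite_induct) (auto simp: act_add)

text \<open>The vectors \<open>x, T x, T\<^sup>2 x, \<dots>\<close> are already dependent over the reals, because \<open>\<complex>\<^sup>n\<close> is a
  finite-dimensional real space.\<close>

lemma ex_annihilating_poly: "\<exists>p. p \<noteq> 0 \<and> act p x = 0"
proof (cases "inj_on (\<lambda>i. (T ^^ i) x) {..DIM(complex ^ 'n)}")
  case False
  then obtain i j where ij: "i \<noteq> j" "(T ^^ i) x = (T ^^ j) x"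
    by (auto simp: inj_on_def)
  let ?p = "monom 1 i + smult (- 1) (monom 1 j) :: complex poly"
  have "coeff ?p i = 1"
    using ij by simp
  then have "?p \<noteq> 0"
    by (metis coeff_0 zero_neq_one)
  moreover have "act ?p x = 0"
    unfolding act_add act_smult act_monom using ij by (simp add: vector_sneg_minus1[symmetric])
  ultimately show ?thesis by blast
next
  case True
  let ?f = "\<lambda>i. (T ^^ i) x" and ?I = "{..DIM(complex ^ 'n)}"
  have "card (?f ` ?I) > DIM(complex ^ 'n)"
    using True by (simp add: card_image)
  then have "dependent (?f ` ?I)"
    by (intro dependent_biggerset)
  then obtain u where u: "\<exists>v\<in>?f ` ?I. u v \<noteq> 0" "(\<Sum>v\<in>?f ` ?I. u v *\<^sub>R v) = 0"
    by (subst (asm) real_vector.dependent_finite) auto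
  let ?p = "\<Sum>i\<in>?I. monom (complex_of_real (u (?f i))) i"
  obtain k where k: "k \<in> ?I" "u (?f k) \<noteq> 0"
    using u(1) by blast
  have "coeff ?p k = (\<Sum>i\<in>?I. if i = k then complex_of_real (u (?f i)) else 0)"
    by (simp add: coeff_sum)
  also have "\<dots> = complex_of_real (u (?f k))"
    using k by (subst sum.delta) auto
  finally have "?p \<noteq> 0"
    using k by (metis coeff_0 of_real_eq_0_iff)
  have "act ?p x = (\<Sum>i\<in>?I. complex_of_real (u (?f i)) *s ?f i)"
    by (simp add: act_sum act_monom)
  also have "\<dots> = (\<Sum>i\<in>?I. u (?f i) *\<^sub>R ?f i)"
    by (intro sum.cong refl) (simp add: vec_eq_iff, simp add: scaleR_conv_of_real)
  also have "\<dots> = 0"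
    using u(2) True by (simp add: sum.reindex)
  finally show ?thesis
    using \<open>?p \<noteq> 0\<close> by blast
qed

text \<open>Every nonzero invariant subspace \<open>W\<close> contains an eigenvector: let \<open>p\<close> have minimal degree among
  the nonzero polynomials with \<open>p(T) x = 0\<close>, and split off a root, \<open>p = (X - l) q\<close>; then \<open>q(T) x\<close> is
  an eigenvector for \<open>l\<close>.\<close>

lemma ex_eigenvector:
  assumes "x \<in> W" "x \<noteq> 0"
    and W_add: "\<And>u v. u \<in> W \<Longrightarrow> v \<in> W \<Longrightarrow> u + v \<in> W"
    and W_scale: "\<And>c v. v \<in> W \<Longrightarrow> c *s v \<in> W"
    and W_T: "\<And>v. v \<in> W \<Longrightarrow> T v \<in> W"
  obtains v l where "v \<in> W" "v \<noteq> 0" "T v = l *s v"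
proof -
  obtain p where p: "p \<noteq> 0" "act p x = 0"
    and min: "\<And>q. q \<noteq> 0 \<Longrightarrow> act q x = 0 \<Longrightarrow> degree p \<le> degree q"
    using ex_has_least_nat[of "\<lambda>p. p \<noteq> 0 \<and> act p x = 0" _ degree] ex_annihilating_poly[of x]
    by metis
  have "degree p \<noteq> 0"
  proof
    assume "degree p = 0"
    then obtain a where "p = [:a:]"
      using degree_eq_zeroE by blast
    then show False
      using p \<open>x \<noteq> 0\<close> by (simp add: T_0)
  qed
  then obtain l where "poly p l = 0"
    using fundamental_theorem_of_algebra[of p] constant_degree[of p] by auto
  then obtain q where q: "p = [:- l, 1:] * q"
    by (auto simp: poly_eq_0_iff_dvd)
  have "q \<noteq> 0" using p q by auto
  have "degree p = Suc (degree q)"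
    unfolding q using \<open>q \<noteq> 0\<close> by (subst degree_mult_eq) auto
  then have nz: "act q x \<noteq> 0"
    using min[OF \<open>q \<noteq> 0\<close>] by auto
  have "act p x = T (act q x) - l *s act q x"
  proof -
    have "p = smult (- l) q + pCons 0 q"
      unfolding q by simp
    then show ?thesis
      by (simp only: act_add act_smult act_pCons) (simp add: vec_eq_iff)
  qed
  then have "T (act q x) = l *s act q x"
    using p by simp
  moreover have "act r x \<in> W" for r
  proof (induction r)
    case 0
    show ?case using W_scale[OF \<open>x \<in> W\<close>, of 0] by simp
  qed (auto intro: W_add W_scale W_T \<open>x \<in> W\<close>)
  ultimately show thesis
    using that nz by blast
qed

end

section \<open>The tensor Lyapunov equation of a stable matrix\<close>

text \<open>The operator \<open>K \<mapsto> K \<times>\<^sub>1 M + \<dots> + K \<times>\<^sub>r M\<close>. It is linear in \<open>M\<close> as well as in \<open>K\<close>.\<close>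

definition tensor_lyapunov :: "real ^ 'd ^ 'd \<Rightarrow> ('d::finite, 'r::finite) tensor \<Rightarrow> ('d, 'r) tensor" where
  "tensor_lyapunov M K = (\<Sum>n\<in>UNIV. mode_product K n M)"

lemma tensor_lyapunov_nth:
  "tensor_lyapunov M K $ f = (\<Sum>n\<in>UNIV. \<Sum>k\<in>UNIV. K $ (f(n := k)) * M $ f n $ k)"
  by (simp add: tensor_lyapunov_def mode_product_def)

text \<open>The complex version of the mode product, as an operator on complex tensors.\<close>

definition mode_operator ::
    "complex ^ 'd ^ 'd \<Rightarrow> 'r \<Rightarrow> complex ^ ('r \<Rightarrow> 'd) \<Rightarrow> complex ^ ('r::finite \<Rightarrow> 'd::finite)" where
  "mode_operator A n X = (\<chi> f. \<Sum>k\<in>UNIV. X $ (f(n := k)) * A $ f n $ k)"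

interpretation mode_operator: complex_operator "mode_operator A n"
proof
  show "mode_operator A n (x + y) = mode_operator A n x + mode_operator A n y" for x y
    by (simp add: mode_operator_def vec_eq_iff sum.distrib distrib_right)
  show "mode_operator A n (c *s x) = c *s mode_operator A n x" for c x
    by (simp add: mode_operator_def vec_eq_iff sum_distrib_left mult.assoc)
qed

lemma mode_operator_commute:
  "mode_operator A n (mode_operator A m X) = mode_operator A m (mode_operator A n X)"
proof (cases "m = n")
  case False
  show ?thesis
    unfolding mode_operator_def vec_eq_iff
  proof (intro allI, simp add: False False[symmetric] sum_distrib_right)
    fix f :: "'a \<Rightarrow> 'b"
    show "(\<Sum>k\<in>UNIV. \<Sum>j\<in>UNIV. X $ (f(n := k, m := j)) * A $ f m $ j * A $ f n $ k) =
      (\<Sum>k\<in>UNIV. \<Sum>j\<in>UNIV. X $ (f(m := k, n := j)) * A $ f n $ j * A $ f m $ k)"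
      by (subst sum.swap) (simp add: fun_upd_twist[OF False] mult_ac)
  qed
qed simp

lemma mode_operator_sum:
  "mode_operator A n (\<Sum>i\<in>I. X i) = (\<Sum>i\<in>I. mode_operator A n (X i))"
  by (induction I rule: infinite_finite_induct)
    (auto simp: mode_operator.T_add mode_operator.T_0)

text \<open>The mode operators commute, so the kernel of their sum is invariant under each of them; successive
  eigenvectors in it yield a vector that is an eigenvector of all modes in \<open>F\<close> at once.\<close>

lemma common_eigenvector:
  fixes X :: "complex ^ ('r::finite \<Rightarrow> 'd::finite)"
  assumes "X \<noteq> 0" and "(\<Sum>n\<in>UNIV. mode_operator A n X) = 0" and "finite F"
  shows "\<exists>(Y :: complex ^ ('r \<Rightarrow> 'd)) l. Y \<noteq> 0 \<and> (\<Sum>n\<in>UNIV. mode_operator A n Y) = 0 \<and>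
    (\<forall>n\<in>F. mode_operator A n Y = l n *s Y)"
  using \<open>finite F\<close>
proof (induction F)
  case empty
  show ?case using assms by (intro exI[of _ X]) simp
next
  case (insert m F)
  then obtain Y l where Y: "Y \<noteq> 0" "(\<Sum>n\<in>UNIV. mode_operator A n Y) = 0"
    "\<And>n. n \<in> F \<Longrightarrow> mode_operator A n Y = l n *s Y"
    by blast
  define W where "W = {Z. (\<Sum>n\<in>UNIV. mode_operator A n Z) = 0 \<and>
    (\<forall>n\<in>F. mode_operator A n Z = l n *s Z)}"
  have "Y \<in> W"
    using Y by (simp add: W_def)
  moreover have "u + v \<in> W" if "u \<in> W" "v \<in> W" for u v
    using that by (auto simp: W_def mode_operator.T_add sum.distrib vector_add_ldistrib)
  moreover have "c *s v \<in> W" if "v \<in> W" for c v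
    using that by (auto simp: W_def mode_operator.T_scale vec.scale_sum_right[symmetric] mult.commute)
  moreover have "mode_operator A m v \<in> W" if "v \<in> W" for v
  proof -
    have "(\<Sum>n\<in>UNIV. mode_operator A n (mode_operator A m v))
        = mode_operator A m (\<Sum>n\<in>UNIV. mode_operator A n v)"
      unfolding mode_operator_sum by (intro sum.cong refl mode_operator_commute)
    moreover have "mode_operator A n (mode_operator A m v) = l n *s mode_operator A m v"
      if "n \<in> F" for n
      using \<open>v \<in> W\<close> that
      by (subst mode_operator_commute) (simp add: W_def mode_operator.T_scale)
    ultimately show ?thesis
      using that by (simp add: W_def mode_operator.T_0)
  qed
  ultimately obtain Z c where Z: "Z \<in> W" "Z \<noteq> 0" "mode_operator A m Z = c *s Z"
    using Y(1) by (elim mode_operator.ex_eigenvector[of Y W A m])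
  then have "\<forall>n\<in>insert m F. mode_operator A n Z = (l(m := c)) n *s Z"
    using insert.hyps by (auto simp: W_def)
  moreover have "(\<Sum>n\<in>UNIV. mode_operator A n Z) = 0"
    using Z(1) by (simp add: W_def)
  ultimately show ?case
    using Z(2) by blast
qed

text \<open>A nonzero kernel element would give a common eigenvector \<open>Y\<close> of all modes, whose eigenvalues
  \<open>l n\<close> add up to \<open>0\<close>. Each of them is an eigenvalue of \<open>M\<close> and so has negative real part.\<close>

lemma tensor_lyapunov_eq_0_imp:
  fixes K :: "('d::finite, 'r::finite) tensor"
  assumes "stable M" and "tensor_lyapunov M K = 0"
  shows "K = 0"
proof (rule ccontr)
  assume "K \<noteq> 0"
  define A where "A = map_matrix complex_of_real M"
  define X where "X = (\<chi> f. complex_of_real (K $ f))"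
  have "X \<noteq> 0"
    using \<open>K \<noteq> 0\<close> by (auto simp: X_def vec_eq_iff)
  have "(\<Sum>n\<in>UNIV. mode_operator A n X) $ f = complex_of_real (tensor_lyapunov M K $ f)" for f
    by (simp add: mode_operator_def A_def X_def tensor_lyapunov_nth map_matrix_def)
  then have "(\<Sum>n\<in>UNIV. mode_operator A n X) = 0"
    using assms(2) by (simp add: vec_eq_iff)
  from common_eigenvector[OF \<open>X \<noteq> 0\<close> this finite, of UNIV]
  obtain Y :: "complex ^ ('r \<Rightarrow> 'd)" and l where Y: "Y \<noteq> 0"
    "(\<Sum>n\<in>UNIV. mode_operator A n Y) = 0" "\<And>n. mode_operator A n Y = l n *s Y"
    by blast
  obtain f where f: "Y $ f \<noteq> 0"
    using Y(1) by (metis vec_eq_iff zero_index)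
  have neg: "Re (l n) < 0" for n
  proof -
    \<comment> \<open>The mode-\<open>n\<close> fibre of \<open>Y\<close> through \<open>f\<close> is an eigenvector of \<open>M\<close>.\<close>
    define v where "v = (\<chi> k. Y $ (f(n := k)))"
    have "v $ f n \<noteq> 0"
      using f by (simp add: v_def)
    then have "v \<noteq> 0" by auto
    moreover have "(A *v v) $ j = (l n *s v) $ j" for j
    proof -
      have "(A *v v) $ j = mode_operator A n Y $ (f(n := j))"
        by (simp add: matrix_vector_mult_def mode_operator_def v_def mult.commute)
      then show ?thesis
        by (simp add: Y(3) v_def)
    qed
    ultimately have "complex_eigenvalue M (l n)"
      unfolding complex_eigenvalue_def A_def[symmetric] vec_eq_iff[of "A *v _"] by blast
    then show ?thesis
      using \<open>stable M\<close> by (simp add: stable_def)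
  qed
  have "(\<Sum>n\<in>UNIV. l n) * Y $ f = (\<Sum>n\<in>UNIV. mode_operator A n Y) $ f"
    by (simp add: Y(3) sum_distrib_right)
  then have "(\<Sum>n\<in>UNIV. l n) = 0"
    using Y(2) f by simp
  moreover have "(\<Sum>n\<in>UNIV. Re (l n)) < (\<Sum>n\<in>(UNIV :: 'r set). 0)"
    using neg by (intro sum_strict_mono) auto
  ultimately show False
    by (metis Re_sum less_irrefl sum.neutral_const zero_complex.sel(1))
qed

section \<open>Polynomial dependence on the parameters\<close>

lemma real_polynomial_function_det:
  fixes A :: "'a::real_normed_vector \<Rightarrow> real ^ 'n ^ 'n"
  assumes "\<And>i j. real_polynomial_function (\<lambda>x. A x $ i $ j)"
  shows "real_polynomial_function (\<lambda>x. det (A x))"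
  unfolding det_def
  by (intro real_polynomial_function_sum real_polynomial_function.intros(4)
      real_polynomial_function.intros(2) real_polynomial_function_prod assms finite_permutations) auto

text \<open>If \<open>B\<close> is a left inverse of \<open>L a\<close>, then \<open>p x = det (B (L x))\<close> is a polynomial that certifies
  injectivity of \<open>L x\<close> and takes the value \<open>1\<close> at \<open>a\<close>.\<close>

lemma injectivity_is_polynomially_open:
  fixes L :: "'a::real_normed_vector \<Rightarrow> real ^ 'n \<Rightarrow> real ^ 'm"
  assumes lin: "\<And>x. linear (L x)"
    and poly: "\<And>v w. real_polynomial_function (\<lambda>x. L x v $ w)"
    and inj: "inj (L a)"
  obtains p where "real_polynomial_function p" "p a \<noteq> 0" "\<And>x. p x \<noteq> 0 \<Longrightarrow> inj (L x)"
proof -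
  have mat: "(*v) (matrix (L x)) = L x" for x
    using lin by (simp add: matrix_works fun_eq_iff)
  have "inj ((*v) (matrix (L a)))"
    using inj by (simp add: mat)
  then obtain B where B: "B ** matrix (L a) = mat 1"
    by (auto simp: matrix_left_invertible_injective[symmetric])
  define p where "p x = det (B ** matrix (L x))" for x
  show thesis
  proof (rule that)
    show "real_polynomial_function p"
      unfolding p_def matrix_matrix_mult_def
      by (intro real_polynomial_function_det)
        (auto simp: matrix_def intro!: poly real_polynomial_function.intros(4))
    show "p a \<noteq> 0"
      by (simp add: p_def B)
  next
    fix x
    assume "p x \<noteq> 0"
    then have "inj ((*v) (B ** matrix (L x)))"
      by (simp add: p_def inj_matrix_vector_mult invertible_det_nz)
    then have "inj ((*v) (matrix (L x)))"
      by (auto simp: inj_def matrix_vector_mul_assoc[symmetric])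
    then show "inj (L x)"
      by (simp add: mat)
  qed
qed

section \<open>Solutions of tensor Lyapunov equations\<close>

lemma tensor_lyapunov_add_right: "tensor_lyapunov M (K + K') = tensor_lyapunov M K + tensor_lyapunov M K'"
  and tensor_lyapunov_scaleR_right: "tensor_lyapunov M (c *\<^sub>R K) = c *\<^sub>R tensor_lyapunov M K"
  and tensor_lyapunov_add_left: "tensor_lyapunov (M + M') K = tensor_lyapunov M K + tensor_lyapunov M' K"
  and tensor_lyapunov_scaleR_left: "tensor_lyapunov (c *\<^sub>R M) K = c *\<^sub>R tensor_lyapunov M K"
  by (simp_all add: vec_eq_iff tensor_lyapunov_nth sum.distrib distrib_left distrib_right
      sum_distrib_left mult_ac)

lemma linear_tensor_lyapunov_right: "linear (tensor_lyapunov M)"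
  by (intro linearI tensor_lyapunov_add_right tensor_lyapunov_scaleR_right)

lemma diag_tensor_scaleR: "diag_tensor (c *\<^sub>R a) = c *\<^sub>R diag_tensor a"
  by (simp add: diag_tensor_def vec_eq_iff sum_distrib_left if_distrib cong: if_cong)

lemma diag_tensor_const: "diag_tensor a $ (\<lambda>_. k) = a $ k"
proof -
  have "(\<Sum>j\<in>UNIV. if (\<lambda>_. k) = (\<lambda>_. j) then a $ j else 0) = (\<Sum>j\<in>UNIV. if j = k then a $ j else 0)"
    by (intro sum.cong) (auto simp: fun_eq_iff)
  then show ?thesis
    by (simp add: diag_tensor_def)
qed

lemma diag_tensor_nonconst: "\<nexists>k. f = (\<lambda>_. k) \<Longrightarrow> diag_tensor a $ f = 0"
  by (simp add: diag_tensor_def)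

text \<open>The square matrix of the Lyapunov operator on tensors of order \<open>CARD('r)\<close>.\<close>

definition lyapunov_matrix :: "real ^ 'd ^ 'd \<Rightarrow> real ^ ('r::finite \<Rightarrow> 'd::finite) ^ ('r \<Rightarrow> 'd)" where
  "lyapunov_matrix M = matrix (tensor_lyapunov M)"

lemma lyapunov_matrix_works: "lyapunov_matrix M *v K = tensor_lyapunov M K"
  by (simp add: lyapunov_matrix_def matrix_works linear_tensor_lyapunov_right)

lemma det_lyapunov_matrix:
  assumes "stable M"
  shows "det (lyapunov_matrix M) \<noteq> 0"
proof -
  have "inj ((*v) (lyapunov_matrix M))"
    unfolding vec.inj_iff_eq_0
    using tensor_lyapunov_eq_0_imp[OF assms] by (auto simp: lyapunov_matrix_works)
  then show ?thesis
    by (simp add: inj_matrix_vector_mult matrix_left_invertible_injective[symmetric]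
        invertible_left_inverse invertible_det_nz[symmetric])
qed

text \<open>The tensor of order \<open>CARD('r)\<close> that solves the Lyapunov equation with diagonal \<open>c\<close>; it is well defined
  for stable \<open>M\<close>.\<close>

definition lyapunov_solution :: "real ^ 'd ^ 'd \<Rightarrow> real ^ 'd \<Rightarrow> ('d::finite, 'r::finite) tensor" where
  "lyapunov_solution M c = (THE K. tensor_lyapunov M K + diag_tensor c = 0)"

text \<open>The numerators in Cramer's rule: the solution multiplied by the determinant of the system.
  Unlike the solution itself, this is polynomial in the parameters.\<close>

definition cleared_solution :: "real ^ 'd ^ 'd \<Rightarrow> real ^ 'd \<Rightarrow> ('d::finite, 'r::finite) tensor" where
  "cleared_solution M c =
    (\<chi> k. det (\<chi> i j. if j = k then - diag_tensor c $ i else lyapunov_matrix M $ i $ j))"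

lemma
  fixes K :: "('d::finite, 'r::finite) tensor"
  assumes "stable M"
  shows lyapunov_solution_iff: "tensor_lyapunov M K + diag_tensor c = 0 \<longleftrightarrow> K = lyapunov_solution M c"
    and cleared_solution_eq: "cleared_solution M c = det (lyapunov_matrix M :: real ^ ('r \<Rightarrow> 'd) ^ ('r \<Rightarrow> 'd)) *\<^sub>R
      (lyapunov_solution M c :: ('d, 'r) tensor)"
proof -
  let ?D = "det (lyapunov_matrix M :: real ^ ('r \<Rightarrow> 'd) ^ ('r \<Rightarrow> 'd))"
  have *: "tensor_lyapunov M K + diag_tensor c = 0 \<longleftrightarrow> K = (1 / ?D) *\<^sub>R cleared_solution M c"
    for K :: "('d, 'r) tensor"
  proof -
    have "tensor_lyapunov M K + diag_tensor c = 0 \<longleftrightarrow> lyapunov_matrix M *v K = - diag_tensor c"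
      by (simp add: lyapunov_matrix_works eq_neg_iff_add_eq_0)
    also have "\<dots> \<longleftrightarrow> K = (1 / ?D) *\<^sub>R cleared_solution M c"
      unfolding cramer[OF det_lyapunov_matrix[OF assms]]
      by (simp add: cleared_solution_def vec_eq_iff cong: if_cong)
    finally show ?thesis .
  qed
  then have "(lyapunov_solution M c :: ('d, 'r) tensor) = (1 / ?D) *\<^sub>R cleared_solution M c"
    unfolding lyapunov_solution_def by simp
  then show "tensor_lyapunov M K + diag_tensor c = 0 \<longleftrightarrow> K = lyapunov_solution M c"
    and "cleared_solution M c = ?D *\<^sub>R (lyapunov_solution M c :: ('d, 'r) tensor)"
    using * det_lyapunov_matrix[OF assms, where 'b = 'r] by simp_all
qed

lemma real_polynomial_function_cleared_solution:
  fixes M :: "'a::real_normed_vector \<Rightarrow> real ^ 'd ^ 'd"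
  assumes "\<And>i j. real_polynomial_function (\<lambda>x. M x $ i $ j)"
    and "\<And>i. real_polynomial_function (\<lambda>x. c x $ i)"
  shows "real_polynomial_function (\<lambda>x. (cleared_solution (M x) (c x) :: ('d::finite, 'r::finite) tensor) $ k)"
proof -
  have A: "real_polynomial_function (\<lambda>x. lyapunov_matrix (M x) $ (f :: 'r \<Rightarrow> 'd) $ g)" for f g
    unfolding lyapunov_matrix_def matrix_def vec_lambda_beta tensor_lyapunov_nth
    by (intro real_polynomial_function_sum real_polynomial_function.intros(4) assms
        real_polynomial_function.intros(2)) auto
  have C: "real_polynomial_function (\<lambda>x. - diag_tensor (c x) $ (f :: 'r \<Rightarrow> 'd))" for f
  proof (cases "\<exists>k. f = (\<lambda>_. k)")
    case True
    then show ?thesis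
      using assms(2) by (auto simp: diag_tensor_const)
  next
    case False
    then show ?thesis
      by (simp add: diag_tensor_nonconst real_polynomial_function.intros(2))
  qed
  show ?thesis
    unfolding cleared_solution_def vec_lambda_beta
  proof (intro real_polynomial_function_det, unfold vec_lambda_beta)
    fix i j
    show "real_polynomial_function
      (\<lambda>x. if j = k then - diag_tensor (c x) $ i else lyapunov_matrix (M x) $ i $ j)"
      by (cases "j = k") (simp_all add: A C)
  qed
qed

section \<open>The parametrization in terms of tensor Lyapunov equations\<close>

text \<open>A matrix is regarded as a tensor with the two modes \<open>True\<close> (row) and \<open>False\<close> (column), so that the
  second-order Lyapunov equation becomes an instance of the tensor equation.\<close>

definition tensor_of_matrix :: "real ^ 'd ^ 'd \<Rightarrow> ('d::finite, bool) tensor" where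
  "tensor_of_matrix S = (\<chi> f. S $ f True $ f False)"

definition matrix_of_tensor :: "('d::finite, bool) tensor \<Rightarrow> real ^ 'd ^ 'd" where
  "matrix_of_tensor T = (\<chi> i j. T $ (\<lambda>b. if b then i else j))"

lemma matrix_of_tensor_of_matrix: "matrix_of_tensor (tensor_of_matrix S) = S"
  by (simp add: matrix_of_tensor_def tensor_of_matrix_def vec_eq_iff)

lemma tensor_of_matrix_of_tensor: "tensor_of_matrix (matrix_of_tensor T) = T"
proof -
  have "(\<lambda>b. if b then f True else f False) = f" for f :: "bool \<Rightarrow> 'a"
    by (auto simp: fun_eq_iff)
  then show ?thesis
    by (simp add: matrix_of_tensor_def tensor_of_matrix_def vec_eq_iff)
qed

lemma matrix_lyapunov_iff:
  "M ** S + S ** transpose M + diag_matrix c = 0 \<longleftrightarrow>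
    tensor_lyapunov M (tensor_of_matrix S) + diag_tensor c = 0"
proof -
  have *: "(M ** S + S ** transpose M + diag_matrix c) $ f True $ f False =
    (tensor_lyapunov M (tensor_of_matrix S) + diag_tensor c) $ f" for f :: "bool \<Rightarrow> 'a"
  proof -
    have "diag_matrix c $ f True $ f False = diag_tensor c $ f"
    proof (cases "f True = f False")
      case True
      have "f b = f True" for b
        using True by (cases b) simp_all
      then obtain k where k: "f = (\<lambda>_. k)"
        by (metis ext)
      show ?thesis
        unfolding k diag_tensor_const by (simp add: diag_matrix_def)
    next
      case False
      then have "\<nexists>k. f = (\<lambda>_. k)" by auto
      then show ?thesis
        using False by (simp add: diag_matrix_def diag_tensor_nonconst)
    qed
    then show ?thesis
      by (simp add: tensor_lyapunov_nth UNIV_bool matrix_matrix_mult_def transpose_def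
          tensor_of_matrix_def mult.commute add.commute)
  qed
  show ?thesis
  proof
    assume "M ** S + S ** transpose M + diag_matrix c = 0"
    then show "tensor_lyapunov M (tensor_of_matrix S) + diag_tensor c = 0"
      using * by (simp add: vec_eq_iff)
  next
    assume "tensor_lyapunov M (tensor_of_matrix S) + diag_tensor c = 0"
    then have "(M ** S + S ** transpose M + diag_matrix c) $ i $ j = 0" for i j
      using *[of "\<lambda>b. if b then i else j"] by simp
    then show "M ** S + S ** transpose M + diag_matrix c = 0"
      by (simp add: vec_eq_iff)
  qed
qed

lemma phi_stable:
  assumes "stable M"
  shows "phi TYPE('r::finite) (M, c2, cr) =
    (matrix_of_tensor (lyapunov_solution M c2), lyapunov_solution M cr :: ('d::finite, 'r) tensor)"
proof -
  have "M ** S + S ** transpose M + diag_matrix c2 = 0 \<longleftrightarrow>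
      S = matrix_of_tensor (lyapunov_solution M c2)" for S
    unfolding matrix_lyapunov_iff lyapunov_solution_iff[OF assms]
    by (metis matrix_of_tensor_of_matrix tensor_of_matrix_of_tensor)
  then show ?thesis
    by (simp add: phi_def lyapunov_solution_def tensor_lyapunov_def)
qed

section \<open>Fibres and compatible directions\<close>

text \<open>A compatible direction is a matrix \<open>P\<close> supported on the graph such that \<open>P T\<close> and \<open>P K\<close> (the
  Lyapunov operators applied to \<open>T\<close> and \<open>K\<close>) are diagonal and the \<open>a\<close>-th diagonal entry of \<open>P T\<close>
  vanishes. Adding a small multiple of \<open>P\<close> to the drift matrix changes only the two noise diagonals
  and fixes the \<open>a\<close>-th entry of the first of them; this last condition excludes the rescaling
  \<open>c \<theta>\<close>.\<close>

definition compatible_directions ::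
  "('d::finite) pair_pre_digraph \<Rightarrow> 'd \<Rightarrow> ('d, bool) tensor \<Rightarrow> ('d, 'r::finite) tensor \<Rightarrow> (real ^ 'd ^ 'd) set"
where
  "compatible_directions G a T K = {P \<in> graph_matrices G.
     (\<forall>f. (\<forall>k. f = (\<lambda>_. k) \<longrightarrow> k = a) \<longrightarrow> tensor_lyapunov P T $ f = 0) \<and>
     (\<forall>f. (\<nexists>k. f = (\<lambda>_. k)) \<longrightarrow> tensor_lyapunov P K $ f = 0)}"

lemma compatible_directions_scaled_tensors:
  assumes "s \<noteq> 0" "t \<noteq> 0"
  shows "compatible_directions G a (s *\<^sub>R T) (t *\<^sub>R K) = compatible_directions G a T K"
  using assms by (simp add: compatible_directions_def tensor_lyapunov_scaleR_right)

lemma stable_scaleR: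
  assumes "stable M" "c > 0"
  shows "stable (c *\<^sub>R M)"
  unfolding stable_def
proof (intro allI impI)
  fix l
  assume "complex_eigenvalue (c *\<^sub>R M) l"
  then obtain v where v: "v \<noteq> 0" "map_matrix complex_of_real (c *\<^sub>R M) *v v = l *s v"
    by (auto simp: complex_eigenvalue_def)
  have "map_matrix complex_of_real M *v v = (l / complex_of_real c) *s v"
  proof -
    have "complex_of_real c * (map_matrix complex_of_real M *v v) $ i = l * v $ i" for i
      using arg_cong[OF v(2), of "\<lambda>x. x $ i"]
      by (simp add: matrix_vector_mult_def map_matrix_def sum_distrib_left mult.assoc)
    then show ?thesis
      using \<open>c > 0\<close> by (simp add: vec_eq_iff field_simps)
  qed
  then have "complex_eigenvalue M (l / complex_of_real c)"
    using v(1) by (auto simp: complex_eigenvalue_def)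
  then have "Re (l / complex_of_real c) < 0"
    using \<open>stable M\<close> unfolding stable_def by blast
  then show "Re l < 0"
    using \<open>c > 0\<close> by (simp add: divide_less_0_iff)
qed

lemma lyapunov_solution_scaleR:
  assumes "stable M" "c > 0"
  shows "lyapunov_solution (c *\<^sub>R M) (c *\<^sub>R b) = (lyapunov_solution M b :: ('d::finite, 'r::finite) tensor)"
proof -
  let ?K = "lyapunov_solution M b :: ('d, 'r) tensor"
  have "tensor_lyapunov M ?K + diag_tensor b = 0"
    using lyapunov_solution_iff[OF assms(1)] by blast
  then have "tensor_lyapunov (c *\<^sub>R M) ?K + diag_tensor (c *\<^sub>R b) = 0"
    by (simp add: tensor_lyapunov_scaleR_left diag_tensor_scaleR scaleR_add_right[symmetric])
  then show ?thesis
    using lyapunov_solution_iff[OF stable_scaleR[OF assms]] by metis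
qed

text \<open>If \<open>(M', b\<^sub>2, b\<^sub>r)\<close> lies in the fibre of \<open>(M, c\<^sub>2, c\<^sub>r)\<close>, then \<open>M' - c M\<close> is a compatible direction
  for the scalar \<open>c\<close> that matches the \<open>a\<close>-th entries of \<open>b\<^sub>2\<close> and \<open>c c\<^sub>2\<close>.\<close>

lemma fibre_eq_ray:
  fixes G :: "('d::finite) pair_pre_digraph"
  assumes \<theta>: "(M, c2, cr) \<in> Theta G"
    and trivial: "compatible_directions G a (lyapunov_solution M c2)
      (lyapunov_solution M cr :: ('d, 'r::finite) tensor) \<subseteq> {0}"
  shows "{\<eta> \<in> Theta G. phi TYPE('r) \<eta> = phi TYPE('r) (M, c2, cr)} = {c *\<^sub>R (M, c2, cr) | c. c > 0}"
proof (intro subset_antisym subsetI)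
  let ?T = "lyapunov_solution M c2 :: ('d, bool) tensor"
  let ?K = "lyapunov_solution M cr :: ('d, 'r) tensor"
  have M: "M \<in> graph_matrices G" "stable M" and c2: "\<And>i. c2 $ i > 0" and cr: "\<And>i. cr $ i \<noteq> 0"
    using \<theta> by (auto simp: Theta_def)
  {
    fix \<eta>
    assume "\<eta> \<in> {c *\<^sub>R (M, c2, cr) | c. c > 0}"
    then obtain c where c: "c > 0" "\<eta> = (c *\<^sub>R M, c *\<^sub>R c2, c *\<^sub>R cr)"
      by auto
    have "\<eta> \<in> Theta G"
      using c M c2 cr stable_scaleR[of M c] by (auto simp: Theta_def graph_matrices_def)
    moreover have "phi TYPE('r) \<eta> = phi TYPE('r) (M, c2, cr)"
      unfolding c(2) by (simp add: phi_stable stable_scaleR lyapunov_solution_scaleR M c(1))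
    ultimately show "\<eta> \<in> {\<eta> \<in> Theta G. phi TYPE('r) \<eta> = phi TYPE('r) (M, c2, cr)}"
      by blast
  next
    fix \<eta>
    assume "\<eta> \<in> {\<eta> \<in> Theta G. phi TYPE('r) \<eta> = phi TYPE('r) (M, c2, cr)}"
    moreover obtain M' b2 br where \<eta>: "\<eta> = (M', b2, br)"
      using prod_cases3 by blast
    ultimately have M': "M' \<in> graph_matrices G" "stable M'" and b2: "\<And>i. b2 $ i > 0"
      and phi: "phi TYPE('r) (M', b2, br) = phi TYPE('r) (M, c2, cr)"
      by (auto simp: Theta_def)
    have "lyapunov_solution M' b2 = ?T" and "lyapunov_solution M' br = ?K"
      using phi M(2) M'(2)
      by (auto simp: phi_stable) (metis tensor_of_matrix_of_tensor)
    then have T': "tensor_lyapunov M' ?T = - diag_tensor b2"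
      and K': "tensor_lyapunov M' ?K = - diag_tensor br"
      using lyapunov_solution_iff[OF M'(2)] by (metis eq_neg_iff_add_eq_0)+
    have T: "tensor_lyapunov M ?T = - diag_tensor c2"
      and K: "tensor_lyapunov M ?K = - diag_tensor cr"
      using lyapunov_solution_iff[OF M(2)] by (metis eq_neg_iff_add_eq_0)+
    define c where "c = b2 $ a / c2 $ a"
    have "c > 0"
      using b2 c2 by (simp add: c_def)
    define P where "P = M' + (- c) *\<^sub>R M"
    have PT: "tensor_lyapunov P ?T = c *\<^sub>R diag_tensor c2 - diag_tensor b2"
      and PK: "tensor_lyapunov P ?K = c *\<^sub>R diag_tensor cr - diag_tensor br"
      unfolding P_def tensor_lyapunov_add_left tensor_lyapunov_scaleR_left T K T' K' by simp_all
    have "tensor_lyapunov P ?T $ f = 0" if "\<forall>k. f = (\<lambda>_. k) \<longrightarrow> k = a" for f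
    proof (cases "\<exists>k. f = (\<lambda>_. k)")
      case True
      then have f: "f = (\<lambda>_. a)"
        using that by blast
      have "c2 $ a \<noteq> 0"
        using c2[of a] by simp
      then show ?thesis
        unfolding PT f by (simp add: diag_tensor_const c_def)
    next
      case False
      then show ?thesis
        by (simp add: PT diag_tensor_nonconst)
    qed
    moreover have "tensor_lyapunov P ?K $ f = 0" if "\<nexists>k. f = (\<lambda>_. k)" for f
      using that by (simp add: PK diag_tensor_nonconst)
    moreover have "P \<in> graph_matrices G"
      using M M' by (simp add: P_def graph_matrices_def)
    ultimately have "P \<in> compatible_directions G a ?T ?K"
      by (simp add: compatible_directions_def)
    then have "P = 0"
      using trivial by blast
    then have "M' = c *\<^sub>R M"
      by (simp add: P_def)
    have 0: "tensor_lyapunov 0 L = 0" for L :: "('d, 's::finite) tensor"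
      using tensor_lyapunov_scaleR_left[of 0 0 L] by simp
    have "b2 $ k = c * c2 $ k" for k
      using arg_cong[OF PT, of "\<lambda>x. x $ (\<lambda>_. k)"] \<open>P = 0\<close> by (simp add: 0 diag_tensor_const)
    moreover have "br $ k = c * cr $ k" for k
      using arg_cong[OF PK, of "\<lambda>x. x $ (\<lambda>_. k)"] \<open>P = 0\<close> by (simp add: 0 diag_tensor_const)
    ultimately have "\<eta> = c *\<^sub>R (M, c2, cr)"
      using \<open>M' = c *\<^sub>R M\<close> by (simp add: \<eta> vec_eq_iff)
    then show "\<eta> \<in> {c *\<^sub>R (M, c2, cr) | c. c > 0}"
      using \<open>c > 0\<close> by blast
  }
qed

text \<open>The linear equations that define the compatible directions, collected in one vector. The three
  blocks of indices are the entries of \<open>P T\<close>, the entries of \<open>P K\<close> and the entries of \<open>P\<close>;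
  an entry that imposes no condition is replaced by \<open>0\<close>.\<close>

definition compatibility_map ::
  "('d::finite) pair_pre_digraph \<Rightarrow> 'd \<Rightarrow> ('d, bool) tensor \<Rightarrow> ('d, 'r::finite) tensor \<Rightarrow>
    real ^ 'd ^ 'd \<Rightarrow> real ^ ((bool \<Rightarrow> 'd) + ('r \<Rightarrow> 'd) + ('d \<times> 'd))"
where
  "compatibility_map G a T K P = (\<chi> w. case w of
      Inl f \<Rightarrow> if \<forall>k. f = (\<lambda>_. k) \<longrightarrow> k = a then tensor_lyapunov P T $ f else 0
    | Inr (Inl f) \<Rightarrow> if \<nexists>k. f = (\<lambda>_. k) then tensor_lyapunov P K $ f else 0
    | Inr (Inr (i, j)) \<Rightarrow> if (j, i) \<notin> parcs G then P $ i $ j else 0)"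

lemma compatibility_map_nth [simp]:
  "compatibility_map G a T K P $ Inl f =
    (if \<forall>k. f = (\<lambda>_. k) \<longrightarrow> k = a then tensor_lyapunov P T $ f else 0)"
  "compatibility_map G a T K P $ Inr (Inl g) =
    (if \<nexists>k. g = (\<lambda>_. k) then tensor_lyapunov P K $ g else 0)"
  "compatibility_map G a T K P $ Inr (Inr (i, j)) = (if (j, i) \<notin> parcs G then P $ i $ j else 0)"
  by (simp_all add: compatibility_map_def)

lemma vec_eq_iff_sum_index:
  fixes v w :: "real ^ ('a::finite + 'b::finite + ('c::finite \<times> 'c))"
  shows "v = w \<longleftrightarrow> (\<forall>f. v $ Inl f = w $ Inl f) \<and> (\<forall>g. v $ Inr (Inl g) = w $ Inr (Inl g)) \<and>
    (\<forall>i j. v $ Inr (Inr (i, j)) = w $ Inr (Inr (i, j)))"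
  unfolding vec_eq_iff by (metis old.prod.exhaust sum.exhaust)

lemma compatibility_map_eq_0_iff:
  "compatibility_map G a T K P = 0 \<longleftrightarrow> P \<in> compatible_directions G a T K"
  unfolding vec_eq_iff_sum_index compatible_directions_def graph_matrices_def
  by (auto simp del: split_paired_All)

lemma linear_compatibility_map: "linear (compatibility_map G a T K)"
proof (rule linearI)
  show "compatibility_map G a T K (P + Q) = compatibility_map G a T K P + compatibility_map G a T K Q" for P Q
    unfolding vec_eq_iff_sum_index by (auto simp: tensor_lyapunov_add_left)
  show "compatibility_map G a T K (c *\<^sub>R P) = c *\<^sub>R compatibility_map G a T K P" for c P
    unfolding vec_eq_iff_sum_index by (auto simp: tensor_lyapunov_scaleR_left)
qed

lemma compatible_directions_trivial_iff:
  "compatible_directions G a T K \<subseteq> {0} \<longleftrightarrow> inj (compatibility_map G a T K)"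
  unfolding linear_injective_0[OF linear_compatibility_map] compatibility_map_eq_0_iff by blast

text \<open>The matrix whose entries are listed in a vector.\<close>

definition unvec :: "real ^ ('d \<times> 'd) \<Rightarrow> real ^ 'd ^ ('d::finite)" where
  "unvec x = (\<chi> i j. x $ (i, j))"

lemma linear_unvec: "linear unvec"
  by (rule linearI) (simp_all add: unvec_def vec_eq_iff)

lemma bij_unvec: "bij unvec"
proof (rule bijI)
  show "inj unvec"
    by (auto simp: inj_def unvec_def vec_eq_iff)
  show "surj unvec"
    by (rule surjI[where f = "\<lambda>P. \<chi> q. P $ fst q $ snd q"]) (simp add: unvec_def vec_eq_iff)
qed

text \<open>Replacing both tensors by their Cramer numerators scales them by nonzero factors, which leaves the
  compatible directions unchanged and makes the defining equations polynomial in the parameter.\<close>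

lemma trivial_compatible_directions_polynomial:
  fixes G :: "('d::finite) pair_pre_digraph"
  assumes \<theta>: "(M, c2, cr) \<in> Theta G"
    and trivial: "compatible_directions G a (lyapunov_solution M c2)
      (lyapunov_solution M cr :: ('d, 'r::finite) tensor) \<subseteq> {0}"
  obtains p where "real_polynomial_function p" "p (M, c2, cr) \<noteq> 0"
    "\<And>M' b2 br. (M', b2, br) \<in> Theta G \<Longrightarrow> p (M', b2, br) \<noteq> 0 \<Longrightarrow>
      compatible_directions G a (lyapunov_solution M' b2)
        (lyapunov_solution M' br :: ('d, 'r) tensor) \<subseteq> {0}"
proof -
  define T where "T \<theta> = (cleared_solution (fst \<theta>) (fst (snd \<theta>)) :: ('d, bool) tensor)"
    for \<theta> :: "'d param"
  define K where "K \<theta> = (cleared_solution (fst \<theta>) (snd (snd \<theta>)) :: ('d, 'r) tensor)"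
    for \<theta> :: "'d param"
  define L where "L \<theta> = compatibility_map G a (T \<theta>) (K \<theta>) \<circ> unvec" for \<theta>
  have inj_iff: "inj (L (M', b2, br)) \<longleftrightarrow> compatible_directions G a (lyapunov_solution M' b2)
      (lyapunov_solution M' br :: ('d, 'r) tensor) \<subseteq> {0}"
    if "(M', b2, br) \<in> Theta G" for M' b2 br
  proof -
    have "stable M'"
      using that by (simp add: Theta_def)
    have "inj (L (M', b2, br)) \<longleftrightarrow> inj (compatibility_map G a (T (M', b2, br)) (K (M', b2, br)))"
      unfolding L_def using bij_unvec
      by (metis bij_is_inj bij_is_surj comp_inj_on inj_on_imageI)
    also have "\<dots> \<longleftrightarrow> compatible_directions G a (T (M', b2, br)) (K (M', b2, br)) \<subseteq> {0}"
      by (simp add: compatible_directions_trivial_iff)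
    finally show ?thesis
      by (simp add: T_def K_def cleared_solution_eq[OF \<open>stable M'\<close>]
          compatible_directions_scaled_tensors det_lyapunov_matrix[OF \<open>stable M'\<close>])
  qed
  have coord: "real_polynomial_function (\<lambda>\<theta> :: 'd param. fst \<theta> $ i $ j)"
    "real_polynomial_function (\<lambda>\<theta> :: 'd param. fst (snd \<theta>) $ i)"
    "real_polynomial_function (\<lambda>\<theta> :: 'd param. snd (snd \<theta>) $ i)" for i j
    by (intro real_polynomial_function.intros(1);
        simp add: linear_conv_bounded_linear[symmetric] linear_iff)+
  have TK: "real_polynomial_function (\<lambda>\<theta>. T \<theta> $ f)" "real_polynomial_function (\<lambda>\<theta>. K \<theta> $ g)" for f g
    unfolding T_def K_def by (intro real_polynomial_function_cleared_solution coord)+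
  have lyap: "real_polynomial_function (\<lambda>\<theta>. tensor_lyapunov P (T \<theta>) $ f)"
    "real_polynomial_function (\<lambda>\<theta>. tensor_lyapunov P (K \<theta>) $ g)" for P f g
    unfolding tensor_lyapunov_nth
    by (intro real_polynomial_function_sum real_polynomial_function.intros(4) TK
        real_polynomial_function.intros(2) finite)+
  have "real_polynomial_function (\<lambda>\<theta>. L \<theta> v $ w)" for v w
  proof (cases w)
    case (Inl f)
    then show ?thesis
      by (cases "\<forall>k. f = (\<lambda>_. k) \<longrightarrow> k = a")
        (simp_all add: L_def lyap real_polynomial_function.intros(2) del: not_all)
  next
    case (Inr u)
    show ?thesis
    proof (cases u)
      case (Inl g)
      then show ?thesis
        using Inr by (cases "\<nexists>k. g = (\<lambda>_. k)")
          (simp_all add: L_def lyap real_polynomial_function.intros(2))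
    next
      case (Inr q)
      then show ?thesis
        using \<open>w = Inr u\<close> by (cases q) (simp add: L_def real_polynomial_function.intros(2))
    qed
  qed
  moreover have "linear (L \<theta>)" for \<theta>
    unfolding L_def by (intro linear_compose linear_unvec linear_compatibility_map)
  ultimately obtain p where "real_polynomial_function p" "p (M, c2, cr) \<noteq> 0"
    "\<And>\<theta>. p \<theta> \<noteq> 0 \<Longrightarrow> inj (L \<theta>)"
    using injectivity_is_polynomially_open[of L "(M, c2, cr)"] inj_iff[OF \<theta>] trivial by blast
  then show thesis
    using that inj_iff by blast
qed

section \<open>First-order expansion near minus the identity\<close>

text \<open>An eigenvalue of \<open>-1 + e N\<close> satisfies \<open>\<bar>l + 1\<bar> \<le> e d\<close>, by comparing the entries of an eigenvector
  at an index \<open>i\<close> where it is largest.\<close>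

lemma stable_perturbed_identity:
  fixes N :: "real ^ 'd ^ ('d::finite)" and e :: real
  assumes N: "\<And>i j. \<bar>N $ i $ j\<bar> \<le> 1" and e: "0 \<le> e" "e * CARD('d) < 1"
  shows "stable (- mat 1 + e *\<^sub>R N)"
  unfolding stable_def
proof (intro allI impI)
  fix l
  assume "complex_eigenvalue (- mat 1 + e *\<^sub>R N) l"
  then obtain v where v: "v \<noteq> 0" and eq: "map_matrix complex_of_real (- mat 1 + e *\<^sub>R N) *v v = l *s v"
    by (auto simp: complex_eigenvalue_def)
  obtain i where i: "\<And>k. cmod (v $ k) \<le> cmod (v $ i)"
  proof -
    let ?S = "range (\<lambda>k. cmod (v $ k))"
    have "Max ?S \<in> ?S"
      by (intro Max_in) auto
    then obtain i where "Max ?S = cmod (v $ i)"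
      by blast
    moreover have "cmod (v $ k) \<le> Max ?S" for k
      by (intro Max_ge) auto
    ultimately show thesis
      using that by metis
  qed
  have pos: "cmod (v $ i) > 0"
  proof (rule ccontr)
    assume "\<not> cmod (v $ i) > 0"
    then have "v $ k = 0" for k
      using i[of k] by (metis norm_le_zero_iff not_less order_trans)
    then show False
      using v by (simp add: vec_eq_iff)
  qed
  have "l * v $ i = (\<Sum>k\<in>UNIV. complex_of_real ((- mat 1 + e *\<^sub>R N) $ i $ k) * v $ k)"
    using arg_cong[OF eq, of "\<lambda>x. x $ i"] by (simp add: matrix_vector_mult_def map_matrix_def)
  also have "\<dots> = (\<Sum>k\<in>UNIV. (if k = i then - v $ k else 0) + complex_of_real (e * N $ i $ k) * v $ k)"
    by (intro sum.cong) (auto simp: mat_def algebra_simps)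
  also have "\<dots> = - v $ i + (\<Sum>k\<in>UNIV. complex_of_real (e * N $ i $ k) * v $ k)"
    by (simp add: sum.distrib)
  finally have "(l + 1) * v $ i = (\<Sum>k\<in>UNIV. complex_of_real (e * N $ i $ k) * v $ k)"
    by (simp add: algebra_simps)
  then have "cmod (l + 1) * cmod (v $ i) = cmod (\<Sum>k\<in>UNIV. complex_of_real (e * N $ i $ k) * v $ k)"
    by (metis norm_mult)
  also have "\<dots> \<le> (\<Sum>k\<in>(UNIV :: 'd set). e * cmod (v $ i))"
  proof (rule sum_norm_le)
    fix k
    have "\<bar>N $ i $ k\<bar> * cmod (v $ k) \<le> 1 * cmod (v $ i)"
      by (intro mult_mono N i) auto
    then show "cmod (complex_of_real (e * N $ i $ k) * v $ k) \<le> e * cmod (v $ i)"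
      using e(1) by (simp add: norm_mult abs_mult mult.assoc mult_left_mono)
  qed
  also have "\<dots> = (e * CARD('d)) * cmod (v $ i)"
    by simp
  also have "\<dots> < 1 * cmod (v $ i)"
    using e(2) pos by (intro mult_strict_right_mono)
  finally have "cmod (l + 1) < 1"
    using pos by simp
  then have "Re (l + 1) < 1"
    using complex_Re_le_cmod le_less_trans by blast
  then show "Re l < 0"
    by simp
qed

lemma tensor_lyapunov_mat_1:
  "tensor_lyapunov (mat 1) K = real CARD('r) *\<^sub>R (K :: ('d::finite, 'r::finite) tensor)"
proof -
  have "(\<Sum>k\<in>UNIV. K $ (f(n := k)) * (mat 1 :: real ^ 'd ^ 'd) $ f n $ k) = K $ f" for f n
  proof -
    have "(\<Sum>k\<in>UNIV. K $ (f(n := k)) * (mat 1 :: real ^ 'd ^ 'd) $ f n $ k) =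
        (\<Sum>k\<in>UNIV. if k = f n then K $ (f(n := k)) else 0)"
      by (intro sum.cong) (auto simp: mat_def)
    then show ?thesis
      by simp
  qed
  then show ?thesis
    by (simp add: vec_eq_iff tensor_lyapunov_nth)
qed

text \<open>As the Lyapunov operator of \<open>-1\<close> is \<open>- r\<close>, the equation reads \<open>r K = D + e (N K)\<close>, where \<open>D\<close> is the
  diagonal tensor of \<open>b\<close>.\<close>

lemma lyapunov_solution_fixed_point:
  fixes b :: "real ^ 'd"
  assumes "stable (- mat 1 + e *\<^sub>R N)"
  defines "K \<equiv> lyapunov_solution (- mat 1 + e *\<^sub>R N) b :: ('d::finite, 'r::finite) tensor"
  shows "K = (1 / real CARD('r)) *\<^sub>R diag_tensor b + e *\<^sub>R ((1 / real CARD('r)) *\<^sub>R tensor_lyapunov N K)"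
proof -
  have "tensor_lyapunov (- mat 1 + e *\<^sub>R N) K + diag_tensor b = 0"
    using lyapunov_solution_iff[OF assms(1)] unfolding K_def by blast
  moreover have "- mat 1 + e *\<^sub>R N = (-1) *\<^sub>R mat 1 + e *\<^sub>R N"
    by simp
  ultimately have "tensor_lyapunov ((-1) *\<^sub>R mat 1 + e *\<^sub>R N) K + diag_tensor b = 0"
    by (simp only:)
  then have "real CARD('r) *\<^sub>R K = diag_tensor b + e *\<^sub>R tensor_lyapunov N K"
    unfolding tensor_lyapunov_add_left tensor_lyapunov_scaleR_left tensor_lyapunov_mat_1
    by (simp add: algebra_simps)
  then have "(1 / real CARD('r)) *\<^sub>R (real CARD('r) *\<^sub>R K) =
      (1 / real CARD('r)) *\<^sub>R (diag_tensor b + e *\<^sub>R tensor_lyapunov N K)"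
    by simp
  then show ?thesis
    by (simp add: scaleR_add_right mult.commute)
qed

lemma fixed_point_perturbation:
  fixes A :: "'a::euclidean_space \<Rightarrow> 'a"
  assumes "linear A" and x: "\<And>n :: nat. x n = b + e n *\<^sub>R A (x n)" and e: "e \<longlonglongrightarrow> 0"
  shows "x \<longlonglongrightarrow> b"
proof -
  obtain B where B: "B > 0" "\<And>y. norm (A y) \<le> B * norm y"
    using linear_bounded_pos[OF \<open>linear A\<close>] by blast
  have "\<forall>\<^sub>F n in sequentially. \<bar>e n\<bar> < 1 / (2 * B)"
    using tendstoD[OF e, of "1 / (2 * B)"] B(1) by simp
  then have "\<forall>\<^sub>F n in sequentially. norm (x n - b) \<le> \<bar>e n\<bar> * (B * (2 * norm b))"
  proof eventually_elim
    case (elim n)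
    have "\<bar>e n\<bar> * B \<le> 1 / 2"
      using elim B(1) by (simp add: field_simps)
    have diff: "norm (x n - b) \<le> \<bar>e n\<bar> * (B * norm (x n))"
      using B(2)[of "x n"] x[of n] by (metis abs_ge_zero add_diff_cancel_left' mult_left_mono norm_scaleR)
    also have "\<dots> \<le> 1 / 2 * norm (x n)"
      using \<open>\<bar>e n\<bar> * B \<le> 1 / 2\<close> by (metis mult.assoc mult_right_mono norm_ge_zero)
    finally have "norm (x n) \<le> 2 * norm b"
      using norm_triangle_sub[of "x n" b] by linarith
    then have "\<bar>e n\<bar> * (B * norm (x n)) \<le> \<bar>e n\<bar> * (B * (2 * norm b))"
      using B(1) by (intro mult_left_mono) auto
    then show ?case
      using diff by linarith
  qed
  moreover have "(\<lambda>n. \<bar>e n\<bar> * (B * (2 * norm b))) \<longlonglongrightarrow> 0"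
    using tendsto_mult_left_zero[OF tendsto_rabs_zero[OF e]] by simp
  ultimately have "(\<lambda>n. x n - b) \<longlonglongrightarrow> 0"
    by (rule Lim_null_comparison)
  then show ?thesis
    by (simp add: LIM_zero_iff)
qed

lemma tendsto_tensor_lyapunov [tendsto_intros]:
  assumes "(P \<longlongrightarrow> P0) F" "(K \<longlongrightarrow> K0) F"
  shows "((\<lambda>n. tensor_lyapunov (P n) (K n)) \<longlongrightarrow> tensor_lyapunov P0 K0) F"
proof (rule vec_tendstoI)
  show "((\<lambda>n. tensor_lyapunov (P n) (K n) $ f) \<longlongrightarrow> tensor_lyapunov P0 K0 $ f) F" for f
    unfolding tensor_lyapunov_nth by (intro tendsto_intros assms)
qed

text \<open>Writing \<open>D\<close> for the diagonal tensor of \<open>b\<close>, the solution for \<open>-1 + e N\<close> is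
  \<open>D / r + e (N D) / r\<^sup>2 + o(e)\<close>.\<close>

lemma lyapunov_solution_first_order:
  fixes b :: "real ^ 'd" and e :: "nat \<Rightarrow> real"
  assumes "e \<longlonglongrightarrow> 0" "\<And>n. stable (- mat 1 + e n *\<^sub>R N)"
  obtains K1 where
    "\<And>n. lyapunov_solution (- mat 1 + e n *\<^sub>R N) b =
      (1 / real CARD('r)) *\<^sub>R (diag_tensor b :: ('d::finite, 'r::finite) tensor) + e n *\<^sub>R K1 n"
    "K1 \<longlonglongrightarrow> (1 / (real CARD('r))\<^sup>2) *\<^sub>R tensor_lyapunov N (diag_tensor b)"
proof -
  let ?r = "real CARD('r)"
  let ?D = "(1 / ?r) *\<^sub>R (diag_tensor b :: ('d, 'r) tensor)"
  define K where "K n = (lyapunov_solution (- mat 1 + e n *\<^sub>R N) b :: ('d, 'r) tensor)" for n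
  define K1 where "K1 n = (1 / ?r) *\<^sub>R tensor_lyapunov N (K n)" for n
  have K: "K n = ?D + e n *\<^sub>R K1 n" for n
    using lyapunov_solution_fixed_point[OF assms(2)] by (simp add: K_def K1_def)
  have "linear (\<lambda>K :: ('d, 'r) tensor. (1 / ?r) *\<^sub>R tensor_lyapunov N K)"
    by (intro linear_compose_scale_right linear_tensor_lyapunov_right)
  then have "K \<longlonglongrightarrow> ?D"
    using K assms(1) unfolding K1_def by (rule fixed_point_perturbation)
  then have "K1 \<longlonglongrightarrow> (1 / ?r) *\<^sub>R tensor_lyapunov N ?D"
    unfolding K1_def by (intro tendsto_intros)
  moreover have "(1 / ?r) *\<^sub>R tensor_lyapunov N ?D = (1 / ?r\<^sup>2) *\<^sub>R tensor_lyapunov N (diag_tensor b)"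
    by (simp add: tensor_lyapunov_scaleR_right power2_eq_square)
  ultimately show thesis
    using that[of K1] K by (simp add: K_def)
qed

section \<open>Entries of the Lyapunov operator\<close>

lemma ex_notin_of_card_less:
  fixes A :: "'a::finite set"
  assumes "card A < CARD('a)"
  shows "\<exists>x. x \<notin> A"
  using assms by (metis UNIV_eq_I less_irrefl)

text \<open>The entry at an index with \<open>i\<close> in the mode \<open>m\<close> and \<open>j\<close> in the others. Updating a mode other than
  \<open>m\<close> leaves an \<open>i\<close> and, as \<open>r \<ge> 3\<close>, a \<open>j\<close>, so only the mode \<open>m\<close> contributes. For two modes there is a
  second contribution; see the next lemma. This difference is what separates the two orders.\<close>

lemma tensor_lyapunov_diag_tensor_off_diagonal:
  fixes m :: "'r::finite"
  assumes "CARD('r) \<ge> 3" "i \<noteq> j"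
  shows "tensor_lyapunov P (diag_tensor b) $ ((\<lambda>_. j)(m := i)) = P $ i $ j * b $ j"
proof -
  let ?f = "(\<lambda>_. j)(m := i)"
  have "(\<Sum>k\<in>UNIV. diag_tensor b $ (?f(n := k)) * P $ ?f n $ k) = 0" if "n \<noteq> m" for n
  proof -
    have "card {n, m} < CARD('r)"
      using \<open>CARD('r) \<ge> 3\<close> that by simp
    then obtain n' where "n' \<notin> {n, m}"
      using ex_notin_of_card_less by blast
    then have "\<nexists>c. ?f(n := k) = (\<lambda>_. c)" for k
      using that \<open>i \<noteq> j\<close> by (metis fun_upd_other fun_upd_same insertCI)
    then show ?thesis
      by (simp add: diag_tensor_nonconst)
  qed
  then have "tensor_lyapunov P (diag_tensor b) $ ?f =
      (\<Sum>n\<in>UNIV. if n = m then \<Sum>k\<in>UNIV. diag_tensor b $ (?f(n := k)) * P $ ?f n $ k else 0)"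
    unfolding tensor_lyapunov_nth by (intro sum.cong refl) auto
  also have "\<dots> = (\<Sum>k\<in>UNIV. diag_tensor b $ ((\<lambda>_. j)(m := k)) * P $ i $ k)"
    by simp
  also have "\<dots> = (\<Sum>k\<in>UNIV. if k = j then b $ j * P $ i $ j else 0)"
  proof (intro sum.cong refl)
    fix k
    obtain n where "n \<noteq> m"
      using ex_notin_of_card_less[of "{m}"] \<open>CARD('r) \<ge> 3\<close> by auto
    show "diag_tensor b $ ((\<lambda>_. j)(m := k)) * P $ i $ k = (if k = j then b $ j * P $ i $ j else 0)"
    proof (cases "k = j")
      case True
      then have "(\<lambda>_. j)(m := k) = (\<lambda>_. j)" by auto
      then show ?thesis
        using True by (simp add: diag_tensor_const)
    next
      case False
      then have "\<nexists>c. (\<lambda>_. j)(m := k) = (\<lambda>_. c)"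
        using \<open>n \<noteq> m\<close> by (metis fun_upd_other fun_upd_same)
      then show ?thesis
        using False by (simp add: diag_tensor_nonconst)
    qed
  qed
  finally show ?thesis
    by (simp add: mult.commute)
qed

lemma tensor_lyapunov_diag_tensor_bool:
  assumes "i \<noteq> j"
  shows "tensor_lyapunov P (diag_tensor b) $ (\<lambda>x. if x then i else j) = P $ i $ j * b $ j + P $ j $ i * b $ i"
proof -
  let ?f = "\<lambda>x. if x then i else j"
  have D: "diag_tensor b $ (\<lambda>x. if x then p else q) = (if p = q then b $ p else 0)" for p q
  proof (cases "p = q")
    case True
    then have "(\<lambda>x. if x then p else q) = (\<lambda>_. q)" by auto
    then show ?thesis using True by (simp add: diag_tensor_const)
  next
    case False
    then have "\<nexists>c. (\<lambda>x. if x then p else q) = (\<lambda>_. c)"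
      by metis
    then show ?thesis
      using False by (simp add: diag_tensor_nonconst)
  qed
  have upd: "?f(True := k) = (\<lambda>x. if x then k else j)" "?f(False := k) = (\<lambda>x. if x then i else k)" for k
    by auto
  show ?thesis
    by (simp add: tensor_lyapunov_nth UNIV_bool upd D if_distrib[of "\<lambda>x. x * _"] cong: if_cong)
qed

lemma tensor_lyapunov_diagonal:
  assumes "\<And>i j. i \<noteq> j \<Longrightarrow> P $ i $ j = 0"
  shows "tensor_lyapunov P K $ f = (\<Sum>n\<in>UNIV. P $ f n $ f n) * K $ f"
proof -
  have "(\<Sum>k\<in>UNIV. K $ (f(n := k)) * P $ f n $ k) = P $ f n $ f n * K $ f" for n
  proof -
    have "(\<Sum>k\<in>UNIV. K $ (f(n := k)) * P $ f n $ k) =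
        (\<Sum>k\<in>UNIV. if k = f n then P $ f n $ f n * K $ f else 0)"
      using assms by (intro sum.cong refl) (auto simp: mult.commute)
    then show ?thesis by simp
  qed
  then show ?thesis
    by (simp add: tensor_lyapunov_nth sum_distrib_right)
qed

section \<open>A parameter with no nonzero compatible direction\<close>

lemma constant_on_connected_graph:
  fixes G :: "('d::finite) pair_pre_digraph"
  assumes "pverts G = UNIV" and "Digraph_Component.connected (with_proj G)"
    and edge: "\<And>i j. (i, j) \<in> parcs G \<Longrightarrow> h i = h j"
  shows "h i = h j"
proof -
  have "(i, j) \<in> rtrancl_on UNIV (parcs (mk_symmetric (with_proj G)))"
    using assms(1,2)
    by (simp add: Digraph_Component.connected_def strongly_connected_def reachable_def)
  then show ?thesis
    by (induction rule: rtrancl_on_induct) (auto simp: parcs_mk_symmetric dest!: edge)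
qed

text \<open>Compatible directions \<open>P n\<close> at the parameters with drift \<open>-1 + e\<^sub>n N\<close> can only converge to \<open>0\<close>.
  In the limit the equations force \<open>Q\<close> to be diagonal, with \<open>Q\<^sub>a\<^sub>a = 0\<close>. For \<open>i \<noteq> j\<close>, the terms of order
  \<open>e\<^sub>n\<close> in the equations at \<open>(i, j, \<dots>, j)\<close> determine the limit of \<open>P\<^sub>i\<^sub>j / e\<^sub>n\<close>,
  and inserting it into the first-order part of the matrix equation at \<open>(i, j)\<close> gives
  \<open>(r - 2) (N\<^sub>i\<^sub>j s\<^sub>j - N\<^sub>j\<^sub>i s\<^sub>i) (Q\<^sub>i\<^sub>i - Q\<^sub>j\<^sub>j) = 0\<close>. Hence the diagonal of \<open>Q\<close> is constant along edges.\<close>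

lemma limit_direction_eq_0:
  fixes G :: "('d::finite) pair_pre_digraph" and N :: "real ^ 'd ^ 'd" and s c :: "real ^ 'd"
    and K :: "nat \<Rightarrow> ('d, 'r::finite) tensor"
  assumes r: "CARD('r) \<ge> 3"
    and G: "pverts G = UNIV" "Digraph_Component.connected (with_proj G)"
    and s: "\<And>i. s $ i \<noteq> 0" and c: "\<And>i. c $ i \<noteq> 0"
    and N: "\<And>i j. (i, j) \<in> parcs G \<Longrightarrow> i \<noteq> j \<Longrightarrow> N $ i $ j * s $ j \<noteq> N $ j $ i * s $ i"
    and e: "e \<longlonglongrightarrow> 0" "\<And>n. e n \<noteq> 0"
    and T: "\<And>n. T n = (1 / 2) *\<^sub>R diag_tensor s + e n *\<^sub>R T1 n"
      "T1 \<longlonglongrightarrow> (1 / 4) *\<^sub>R tensor_lyapunov N (diag_tensor s)"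
    and K: "\<And>n. K n = (1 / real CARD('r)) *\<^sub>R diag_tensor c + e n *\<^sub>R K1 n"
      "K1 \<longlonglongrightarrow> (1 / (real CARD('r))\<^sup>2) *\<^sub>R tensor_lyapunov N (diag_tensor c)"
    and P: "\<And>n. P n \<in> compatible_directions G a (T n) (K n)" "P \<longlonglongrightarrow> Q"
  shows "Q = 0"
proof -
  let ?r = "real CARD('r)"
  let ?T1 = "(1 / 4) *\<^sub>R tensor_lyapunov N (diag_tensor s) :: ('d, bool) tensor"
  let ?K1 = "(1 / ?r\<^sup>2) *\<^sub>R tensor_lyapunov N (diag_tensor c) :: ('d, 'r) tensor"
  \<comment> \<open>An arbitrary mode.\<close>
  define m :: 'r where "m = undefined"
  have PT: "tensor_lyapunov (P n) (T n) $ f = 0" if "\<And>k. f = (\<lambda>_. k) \<Longrightarrow> k = a" for n f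
    using P(1)[of n] that by (simp add: compatible_directions_def)
  have PK: "tensor_lyapunov (P n) (K n) $ ((\<lambda>_. j)(m := i)) = 0" if "i \<noteq> j" for n i j
  proof -
    obtain m' where "m' \<noteq> m"
      using ex_notin_of_card_less[of "{m}"] r by auto
    then have "\<nexists>k. (\<lambda>_. j)(m := i) = (\<lambda>_. k)"
      using that by (metis fun_upd_other fun_upd_same)
    then show ?thesis
      using P(1)[of n] by (simp add: compatible_directions_def)
  qed
  have T_split: "tensor_lyapunov (P n) (T n) $ f =
      1 / 2 * tensor_lyapunov (P n) (diag_tensor s) $ f + e n * tensor_lyapunov (P n) (T1 n) $ f" for n f
    by (simp add: T(1) tensor_lyapunov_add_right tensor_lyapunov_scaleR_right)
  have K_split: "tensor_lyapunov (P n) (K n) $ f =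
      1 / ?r * tensor_lyapunov (P n) (diag_tensor c) $ f + e n * tensor_lyapunov (P n) (K1 n) $ f" for n f
    by (simp add: K(1) tensor_lyapunov_add_right tensor_lyapunov_scaleR_right)
  have lim_T1: "(\<lambda>n. tensor_lyapunov (P n) (T1 n) $ f) \<longlonglongrightarrow> tensor_lyapunov Q ?T1 $ f" for f
    by (intro tendsto_intros T(2) P(2))
  have lim_K1: "(\<lambda>n. tensor_lyapunov (P n) (K1 n) $ f) \<longlonglongrightarrow> tensor_lyapunov Q ?K1 $ f" for f
    by (intro tendsto_intros K(2) P(2))
  have P_off: "P n $ i $ j * c $ j / ?r = - e n * tensor_lyapunov (P n) (K1 n) $ ((\<lambda>_. j)(m := i))"
    if "i \<noteq> j" for n i j
    using PK[OF that, of n] K_split[of n "(\<lambda>_. j)(m := i)"]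
    by (simp add: tensor_lyapunov_diag_tensor_off_diagonal[OF r that])
  have Q_off: "Q $ i $ j = 0" if "i \<noteq> j" for i j
  proof -
    have "(\<lambda>n. P n $ i $ j * c $ j / ?r) \<longlonglongrightarrow> Q $ i $ j * c $ j / ?r"
      by (intro tendsto_intros P(2)) simp
    moreover have "(\<lambda>n. P n $ i $ j * c $ j / ?r) \<longlonglongrightarrow> - 0 * tensor_lyapunov Q ?K1 $ ((\<lambda>_. j)(m := i))"
      unfolding P_off[OF that] by (intro tendsto_intros e(1) lim_K1)
    ultimately have "Q $ i $ j * c $ j / ?r = 0"
      using LIMSEQ_unique by fastforce
    then show ?thesis
      using c[of j] by simp
  qed
  have Q_diag: "tensor_lyapunov Q L $ f = (\<Sum>n\<in>UNIV. Q $ f n $ f n) * L $ f"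
    for L :: "('d, 's::finite) tensor" and f
    by (rule tensor_lyapunov_diagonal[OF Q_off])
  have "Q $ a $ a = 0"
  proof -
    have "(\<lambda>n. tensor_lyapunov (P n) (T n) $ (\<lambda>_. a)) \<longlonglongrightarrow>
        1 / 2 * tensor_lyapunov Q (diag_tensor s) $ (\<lambda>_ :: bool. a) + 0 * tensor_lyapunov Q ?T1 $ (\<lambda>_. a)"
      unfolding T_split by (intro tendsto_intros P(2) e(1) T(2))
    moreover have "tensor_lyapunov (P n) (T n) $ (\<lambda>_. a) = 0" for n
      by (rule PT) (simp add: fun_eq_iff)
    ultimately have "tensor_lyapunov Q (diag_tensor s) $ (\<lambda>_ :: bool. a) = 0"
      by (simp add: LIMSEQ_const_iff)
    then show ?thesis
      using s[of a] by (simp add: Q_diag diag_tensor_const UNIV_bool)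
  qed
  have rate: "(\<lambda>n. P n $ i $ j / e n) \<longlonglongrightarrow> - (Q $ i $ i + (?r - 1) * Q $ j $ j) * N $ i $ j / ?r"
    if "i \<noteq> j" for i j
  proof -
    let ?f = "(\<lambda>_. j)(m := i) :: 'r \<Rightarrow> 'd"
    have "P n $ i $ j / e n = - (?r / c $ j) * tensor_lyapunov (P n) (K1 n) $ ?f" for n
      using P_off[OF that, of n] e(2)[of n] c[of j] by (simp add: field_simps)
    then have "(\<lambda>n. P n $ i $ j / e n) \<longlonglongrightarrow> - (?r / c $ j) * tensor_lyapunov Q ?K1 $ ?f"
      by (simp only:) (intro tendsto_intros lim_K1)
    moreover have "tensor_lyapunov Q ?K1 $ ?f = (Q $ i $ i + (?r - 1) * Q $ j $ j) * (N $ i $ j * c $ j / ?r\<^sup>2)"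
    proof -
      have "(\<Sum>n\<in>UNIV. Q $ ?f n $ ?f n) = Q $ ?f m $ ?f m + (\<Sum>n\<in>UNIV - {m}. Q $ ?f n $ ?f n)"
        by (rule sum.remove) auto
      also have "(\<Sum>n\<in>UNIV - {m}. Q $ ?f n $ ?f n) = (\<Sum>n\<in>UNIV - {m}. Q $ j $ j)"
        by (intro sum.cong) auto
      also have "\<dots> = (?r - 1) * Q $ j $ j"
        using r by (simp add: card_Diff_singleton of_nat_diff)
      finally have "(\<Sum>n\<in>UNIV. Q $ ?f n $ ?f n) = Q $ i $ i + (?r - 1) * Q $ j $ j"
        by simp
      then show ?thesis
        unfolding Q_diag vector_scaleR_component tensor_lyapunov_diag_tensor_off_diagonal[OF r that]
        by simp
    qed
    moreover have "- (?r / c $ j) * ((Q $ i $ i + (?r - 1) * Q $ j $ j) * (N $ i $ j * c $ j / ?r\<^sup>2)) =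
        - (Q $ i $ i + (?r - 1) * Q $ j $ j) * N $ i $ j / ?r"
      using c[of j] by (simp add: field_simps power2_eq_square)
    ultimately show ?thesis
      by simp
  qed
  have "Q $ i $ i = Q $ j $ j" if "(i, j) \<in> parcs G" for i j
  proof (cases "i = j")
    case False
    let ?f = "\<lambda>x. if x then i else j"
    let ?A = "- (Q $ i $ i + (?r - 1) * Q $ j $ j) * N $ i $ j / ?r"
    let ?B = "- (Q $ j $ j + (?r - 1) * Q $ i $ i) * N $ j $ i / ?r"
    have eq: "1 / 2 * (P n $ i $ j / e n * s $ j + P n $ j $ i / e n * s $ i) =
        - tensor_lyapunov (P n) (T1 n) $ ?f" for n
    proof -
      have "tensor_lyapunov (P n) (T n) $ ?f = 0"
        by (rule PT) (metis False)
      then have "1 / 2 * (P n $ i $ j * s $ j + P n $ j $ i * s $ i) =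
          - e n * tensor_lyapunov (P n) (T1 n) $ ?f"
        unfolding T_split tensor_lyapunov_diag_tensor_bool[OF False] mult_minus_left by linarith
      then show ?thesis
        using e(2)[of n] by (simp add: field_simps)
    qed
    have "(\<lambda>n. 1 / 2 * (P n $ i $ j / e n * s $ j + P n $ j $ i / e n * s $ i))
        \<longlonglongrightarrow> 1 / 2 * (?A * s $ j + ?B * s $ i)"
      using False by (intro tendsto_intros rate) auto
    moreover have "(\<lambda>n. - tensor_lyapunov (P n) (T1 n) $ ?f) \<longlonglongrightarrow> - tensor_lyapunov Q ?T1 $ ?f"
      by (intro tendsto_intros lim_T1)
    ultimately have "1 / 2 * (?A * s $ j + ?B * s $ i) = - tensor_lyapunov Q ?T1 $ ?f"
      unfolding eq by (rule LIMSEQ_unique)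
    also have "tensor_lyapunov Q ?T1 $ ?f =
        (Q $ i $ i + Q $ j $ j) * (1 / 4 * (N $ i $ j * s $ j + N $ j $ i * s $ i))"
      unfolding Q_diag vector_scaleR_component tensor_lyapunov_diag_tensor_bool[OF False]
      by (simp add: UNIV_bool add.commute)
    finally have balance: "1 / 2 * (?A * s $ j + ?B * s $ i) =
        - ((Q $ i $ i + Q $ j $ j) * (1 / 4 * (N $ i $ j * s $ j + N $ j $ i * s $ i)))" .
    have "(?r - 2) * (N $ i $ j * s $ j - N $ j $ i * s $ i) * (Q $ i $ i - Q $ j $ j) =
        4 * ?r * (1 / 2 * (?A * s $ j + ?B * s $ i) -
          - ((Q $ i $ i + Q $ j $ j) * (1 / 4 * (N $ i $ j * s $ j + N $ j $ i * s $ i))))"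
      by (simp add: field_simps)
    then have "(?r - 2) * (N $ i $ j * s $ j - N $ j $ i * s $ i) * (Q $ i $ i - Q $ j $ j) = 0"
      unfolding balance by simp
    then show ?thesis
      using r N[OF that False] by simp
  qed simp
  then have "Q $ i $ i = Q $ a $ a" for i
    by (rule constant_on_connected_graph[OF G])
  then have "Q $ i $ j = 0" for i j
    using Q_off \<open>Q $ a $ a = 0\<close> by (cases "i = j") auto
  then show ?thesis
    by (simp add: vec_eq_iff)
qed

text \<open>The drift is \<open>-1 + e N\<close> with \<open>N\<close> the adjacency matrix without loops and \<open>e\<close> small, the second-order
  noise \<open>s\<close> has distinct positive entries, and the \<open>r\<close>-th-order noise is \<open>1\<close>. If every such parameter
  with \<open>e = e\<^sub>n \<rightarrow> 0\<close> had a compatible direction of norm \<open>1\<close>, these would accumulate at a matrix of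
  norm \<open>1\<close>, contradicting the preceding lemma.\<close>

lemma exists_parameter_with_trivial_compatible_directions:
  fixes G :: "('d::finite) pair_pre_digraph"
  assumes r: "CARD('r::finite) \<ge> 3"
    and G: "pverts G = UNIV" "Digraph_Component.connected (with_proj G)" "\<And>i. (i, i) \<in> parcs G"
  shows "\<exists>M c2 cr. (M, c2, cr) \<in> Theta G \<and>
    compatible_directions G a (lyapunov_solution M c2) (lyapunov_solution M cr :: ('d, 'r) tensor) \<subseteq> {0}"
proof (rule ccontr)
  assume none: "\<not> ?thesis"
  obtain h :: "'d \<Rightarrow> nat" where "inj h"
    using finite_imp_inj_to_nat_seg[of "UNIV :: 'd set"] by auto
  define s :: "real ^ 'd" where "s = (\<chi> i. 1 + real (h i))"
  define c :: "real ^ 'd" where "c = 1"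
  define N :: "real ^ 'd ^ 'd" where "N = (\<chi> i j. if i \<noteq> j \<and> (j, i) \<in> parcs G then 1 else 0)"
  \<comment> \<open>The summand \<open>CARD('d) + 1\<close> ensures \<open>e n * CARD('d) < 1\<close>, hence stability, for every \<open>n\<close>.\<close>
  define e where "e n = 1 / (real n + real CARD('d) + 1)" for n :: nat
  define M where "M n = - mat 1 + e n *\<^sub>R N" for n
  have e_pos: "e n > 0" for n
    by (simp add: e_def add_nonneg_pos)
  have e_lim: "e \<longlonglongrightarrow> 0"
    unfolding e_def by real_asymp
  have stable: "stable (M n)" for n
    unfolding M_def
  proof (rule stable_perturbed_identity)
    show "e n * real CARD('d) < 1"
      by (simp add: e_def field_simps add_nonneg_pos)
  qed (use e_pos[of n] in \<open>auto simp: N_def\<close>)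
  have Theta: "(M n, s, c) \<in> Theta G" for n
    using stable[of n] G(3)
    by (auto simp: Theta_def graph_matrices_def M_def N_def s_def c_def mat_def add_pos_nonneg)
  define T where "T n = (lyapunov_solution (M n) s :: ('d, bool) tensor)" for n
  define K where "K n = (lyapunov_solution (M n) c :: ('d, 'r) tensor)" for n
  have "\<exists>P. P \<in> compatible_directions G a (T n) (K n) \<and> norm P = 1" for n
  proof -
    obtain P where P: "P \<in> compatible_directions G a (T n) (K n)" "P \<noteq> 0"
      using none Theta[of n] unfolding T_def K_def by blast
    have "(1 / norm P) *\<^sub>R P \<in> compatible_directions G a (T n) (K n)"
      using P(1) by (simp add: compatible_directions_def graph_matrices_def tensor_lyapunov_scaleR_left)
    then show ?thesis
      using P(2) by (intro exI[of _ "(1 / norm P) *\<^sub>R P"]) simp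
  qed
  then obtain P where P: "\<And>n. P n \<in> compatible_directions G a (T n) (K n)" "\<And>n. norm (P n) = 1"
    by metis
  have "compact (sphere (0 :: real ^ 'd ^ 'd) 1)" "\<forall>n. P n \<in> sphere 0 1"
    using P(2) by simp_all
  then obtain Q \<sigma> where Q: "norm Q = 1" and \<sigma>: "strict_mono \<sigma>" "(P \<circ> \<sigma>) \<longlonglongrightarrow> Q"
    unfolding compact_def by (metis mem_sphere_0)
  have e\<sigma>: "(\<lambda>n. e (\<sigma> n)) \<longlonglongrightarrow> 0"
    using LIMSEQ_subseq_LIMSEQ[OF e_lim \<sigma>(1)] by (simp add: o_def)
  obtain T1 where T1:
    "\<And>n. T (\<sigma> n) = (1 / 2) *\<^sub>R diag_tensor s + e (\<sigma> n) *\<^sub>R T1 n"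
    "T1 \<longlonglongrightarrow> (1 / 4) *\<^sub>R tensor_lyapunov N (diag_tensor s)"
    using lyapunov_solution_first_order[OF e\<sigma> stable[unfolded M_def], of s, where 'r = bool]
    unfolding T_def M_def by (auto simp: card_UNIV_bool)
  obtain K1 where K1:
    "\<And>n. K (\<sigma> n) = (1 / real CARD('r)) *\<^sub>R diag_tensor c + e (\<sigma> n) *\<^sub>R K1 n"
    "K1 \<longlonglongrightarrow> (1 / (real CARD('r))\<^sup>2) *\<^sub>R tensor_lyapunov N (diag_tensor c)"
    using lyapunov_solution_first_order[OF e\<sigma> stable[unfolded M_def], of c, where 'r = 'r]
    unfolding K_def M_def by blast
  have "Q = 0"
  proof (rule limit_direction_eq_0[OF r G(1,2) _ _ _ e\<sigma> _ T1 K1])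
    show "s $ i \<noteq> 0" "c $ i \<noteq> 0" "e (\<sigma> n) \<noteq> 0" for i n
      using e_pos[of "\<sigma> n"] by (simp_all add: s_def c_def add_nonneg_eq_0_iff)
    \<comment> \<open>If the edge has no reverse, one side is \<open>0\<close> and the other is not; otherwise the entries of \<open>s\<close> differ.\<close>
    show "N $ i $ j * s $ j \<noteq> N $ j $ i * s $ i" if "(i, j) \<in> parcs G" "i \<noteq> j" for i j
      using that \<open>inj h\<close> by (auto simp: N_def s_def inj_def add_nonneg_eq_0_iff)
    show "P (\<sigma> n) \<in> compatible_directions G a (T (\<sigma> n)) (K (\<sigma> n))" for n
      by (rule P(1))
    show "(\<lambda>n. P (\<sigma> n)) \<longlonglongrightarrow> Q"
      using \<sigma>(2) by (simp add: o_def)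
  qed
  then show False
    using Q by simp
qed

theorem theorem1:
  fixes G :: "('d::finite) pair_pre_digraph"
  assumes "CARD('d) \<ge> 2"
    and "CARD('r::finite) \<ge> 3"
    and "pverts G = UNIV"
    and "Digraph_Component.connected (with_proj G)"
    and "\<forall>i. (i, i) \<in> parcs G"
  shows "\<exists>N. proper_algebraic_subset G N \<and>
    (\<forall>\<theta> \<in> Theta G - N.
       {\<eta> \<in> Theta G. phi TYPE('r) \<eta> = phi TYPE('r) \<theta>} = {c *\<^sub>R \<theta> | c. c > 0})"
proof -
  \<comment> \<open>An arbitrary node, at which the scale is normalized.\<close>
  define a :: 'd where "a = undefined"
  obtain M c2 cr where \<theta>: "(M, c2, cr) \<in> Theta G" and
    "compatible_directions G a (lyapunov_solution M c2) (lyapunov_solution M cr :: ('d, 'r) tensor) \<subseteq> {0}"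
    using exists_parameter_with_trivial_compatible_directions[of G a, where 'r = 'r] assms by blast
  then obtain p where p: "real_polynomial_function p" "p (M, c2, cr) \<noteq> 0"
    and trivial: "\<And>M' b2 br. (M', b2, br) \<in> Theta G \<Longrightarrow> p (M', b2, br) \<noteq> 0 \<Longrightarrow>
      compatible_directions G a (lyapunov_solution M' b2)
        (lyapunov_solution M' br :: ('d, 'r) tensor) \<subseteq> {0}"
    by (rule trivial_compatible_directions_polynomial) blast
  define Z where "Z = {\<theta> \<in> Theta G. \<forall>q\<in>{p}. q \<theta> = 0}"
  have "proper_algebraic_subset G Z"
    unfolding proper_algebraic_subset_def
  proof
    show "Z \<subset> Theta G"
      using \<theta> p(2) by (auto simp: Z_def)
    show "\<exists>P. (\<forall>q\<in>P. real_polynomial_function q) \<and> Z = {\<theta> \<in> Theta G. \<forall>q\<in>P. q \<theta> = 0}"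
      unfolding Z_def using p(1) by blast
  qed
  moreover have "{\<eta> \<in> Theta G. phi TYPE('r) \<eta> = phi TYPE('r) \<theta>} = {c *\<^sub>R \<theta> | c. c > 0}"
    if "\<theta> \<in> Theta G - Z" for \<theta>
  proof -
    obtain M' b2 br where eq: "\<theta> = (M', b2, br)"
      using prod_cases3 by blast
    show ?thesis
      unfolding eq
      using that by (intro fibre_eq_ray[where a = a] trivial) (auto simp: eq Z_def)
  qed
  ultimately show ?thesis
    by blast
qed

end
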